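(* Let $0<p<\infty$ and let $T$ be an infinite rooted tree such that the sequence $\{c_n\}$ is unbounded. Then there exists no invertible multiplication operator $M_\psi:\mathbb{T}_p\to\mathbb{T}_\infty$ (with $\psi:T\to\mathbb{C}$).
   Context: Let $T$ be an infinite rooted tree with root $o$; $T$ also denotes its vertex set. For a vertex $v$, $|v|$ is the number of edges in the unique path from $o$ to $v$. For $n\in\mathbb{N}_0=\{0,1,2,\dots\}$, $D_n=\{v\in T:|v|=n\}$, and $c_n$ is the number of elements of $D_n$, assumed finite for each $n$ (so $1\le c_n<\infty$). For $f:T\to\mathbb{C}$ and $0<p<\infty$ put $M_p(n,f)=\left(\frac1{c_n}\sum_{|v|=n}|f(v)|^p\right)^{1/p}$, and $M_\infty(n,f)=\max_{|v|=n}|f(v)|$. For $0<p\le\infty$ put $\|f\|_p=\sup_{n\in\mathbb{N}_0}M_p(n,f)$ and $\mathbb{T}_p=\{f:T\to\mathbb{C}:\|f\|_p<\infty\}$. For $\psi:T\to\mathbb{C}$, $M_\psi f=\psi f$ (pointwise product). A linear operator $A:X\to Y$ is bounded if $\sup\{\|Af\|_Y/\|f\|_X: f\in X, f\neq0\}<\infty$; $M_\psi:X\to Y$ is invertible if it maps $X$ into $Y$, is bounded, and there is a bounded linear operator $B:Y\to X$ with $BM_\psi=I_X$ and $M_\psi B=I_Y$. *)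

theory Defs
  imports
    Complex_Main
    "HOL-Library.Extended_Nonnegative_Real"
    "Graph_Theory.Graph_Theory"
begin

text \<open>
  Undirected graphs are digraphs without loops in which every arc occurs together with its
  reverse. The predicate \<open>tree\<close> of \<open>Graph_Theory\<close> is not usable here: its \<open>forest\<close> only excludes
  directed cycles, so that an edge together with its reverse already counts as a cycle. In an
  undirected graph the genuine cycles are those of length at least three.
\<close>

locale rooted_tree = pair_bidirected_digraph T
  for T :: "'v pair_pre_digraph" +
  fixes r :: 'v
  assumes root_in_verts: "r \<in> pverts T"
    and tree_connected: "Digraph_Component.connected (with_proj T)"
    and tree_acyclic: "\<not> (\<exists>p. cycle p \<and> 3 \<le> length p)"

definition level :: "'v pair_pre_digraph \<Rightarrow> 'v \<Rightarrow> 'v \<Rightarrow> nat" where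
  "level T r v = length (THE p. pre_digraph.apath (with_proj T) r p v)"

definition tree_sphere :: "'v pair_pre_digraph \<Rightarrow> 'v \<Rightarrow> nat \<Rightarrow> 'v set" where
  "tree_sphere T r n = {v \<in> pverts T. level T r v = n}"

definition level_mean ::
  "'v pair_pre_digraph \<Rightarrow> 'v \<Rightarrow> ereal \<Rightarrow> nat \<Rightarrow> ('v \<Rightarrow> complex) \<Rightarrow> real" where
  "level_mean T r p n f =
     (if p = \<infinity> then Max ((\<lambda>v. cmod (f v)) ` tree_sphere T r n)
      else (1 / real (card (tree_sphere T r n)) *
             (\<Sum>v\<in>tree_sphere T r n. cmod (f v) powr real_of_ereal p))
           powr (1 / real_of_ereal p))"

definition tree_norm ::
  "'v pair_pre_digraph \<Rightarrow> 'v \<Rightarrow> ereal \<Rightarrow> ('v \<Rightarrow> complex) \<Rightarrow> ennreal" where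
  "tree_norm T r p f = (SUP n. ennreal (level_mean T r p n f))"

text \<open>
  A function on the vertex set is represented by the function on the whole type that vanishes
  outside the vertex set, so that the pointwise operations on the type restrict to it and the
  representation is unique.
\<close>

definition tree_space :: "'v pair_pre_digraph \<Rightarrow> 'v \<Rightarrow> ereal \<Rightarrow> ('v \<Rightarrow> complex) set" where
  "tree_space T r p = {f. (\<forall>v. v \<notin> pverts T \<longrightarrow> f v = 0) \<and> tree_norm T r p f < \<infinity>}"

definition linear_operator ::
  "('v \<Rightarrow> complex) set \<Rightarrow> ('v \<Rightarrow> complex) set \<Rightarrow> (('v \<Rightarrow> complex) \<Rightarrow> ('v \<Rightarrow> complex)) \<Rightarrow> bool" where
  "linear_operator X Y A \<longleftrightarrow>
     (\<forall>f\<in>X. A f \<in> Y) \<and>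
     (\<forall>f\<in>X. \<forall>g\<in>X. A (\<lambda>v. f v + g v) = (\<lambda>v. A f v + A g v)) \<and>
     (\<forall>c. \<forall>f\<in>X. A (\<lambda>v. c * f v) = (\<lambda>v. c * A f v))"

definition bounded_operator ::
  "'v pair_pre_digraph \<Rightarrow> 'v \<Rightarrow> ereal \<Rightarrow> ereal \<Rightarrow>
    (('v \<Rightarrow> complex) \<Rightarrow> ('v \<Rightarrow> complex)) \<Rightarrow> bool" where
  "bounded_operator T r p q A \<longleftrightarrow>
     linear_operator (tree_space T r p) (tree_space T r q) A \<and>
     (SUP f\<in>tree_space T r p - {\<lambda>v. 0}. tree_norm T r q (A f) / tree_norm T r p f) < \<infinity>"

definition mult_operator :: "('v \<Rightarrow> complex) \<Rightarrow> ('v \<Rightarrow> complex) \<Rightarrow> ('v \<Rightarrow> complex)" where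
  "mult_operator \<psi> f = (\<lambda>v. \<psi> v * f v)"

definition invertible_operator ::
  "'v pair_pre_digraph \<Rightarrow> 'v \<Rightarrow> ereal \<Rightarrow> ereal \<Rightarrow>
    (('v \<Rightarrow> complex) \<Rightarrow> ('v \<Rightarrow> complex)) \<Rightarrow> bool" where
  "invertible_operator T r p q A \<longleftrightarrow>
     bounded_operator T r p q A \<and>
     (\<exists>B. bounded_operator T r q p B \<and>
          (\<forall>f\<in>tree_space T r p. B (A f) = f) \<and>
          (\<forall>g\<in>tree_space T r q. A (B g) = g))"

end

theory Submission
  imports Defs
begin

text \<open>
  Testing \<open>M\<^sub>\<psi>\<close> on the indicator of a vertex \<open>v\<close> with \<open>|v| = n\<close> gives
  \<open>|\<psi>(v)| \<le> \<parallel>M\<^sub>\<psi>\<parallel> c\<^sub>n powr (-1/p)\<close>. Applying the inverse to the indicator of \<open>D\<^sub>n\<close> yields a function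
  of modulus \<open>1/|\<psi>| \<ge> c\<^sub>n powr (1/p) / \<parallel>M\<^sub>\<psi>\<parallel>\<close> on \<open>D\<^sub>n\<close>, whose \<open>p\<close>-norm is bounded independently
  of \<open>n\<close>. Hence \<open>(c\<^sub>n)\<close> is bounded.
\<close>

text \<open>Turns the finite supremum of quotients into the usual estimate by a real constant. No
  definiteness of \<open>tree_norm\<close> enters: a nonzero \<open>f\<close> of norm 0 is handled
  by the division conventions of \<open>ennreal\<close>.\<close>

lemma bounded_operator_norm_le:
  assumes "bounded_operator T r p q A"
  obtains C where "0 < C"
    "\<And>f. f \<in> tree_space T r p \<Longrightarrow> f \<noteq> (\<lambda>v. 0) \<Longrightarrow>
       tree_norm T r q (A f) \<le> ennreal C * tree_norm T r p f"
proof -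
  define S where
    "S = (SUP f\<in>tree_space T r p - {\<lambda>v. 0}. tree_norm T r q (A f) / tree_norm T r p f)"
  have fin: "S < \<infinity>"
    using assms by (simp add: bounded_operator_def S_def)
  \<comment> \<open>The summand 1 keeps the constant positive even when \<open>S\<close> is
    0.\<close>
  then have S: "S \<le> ennreal (enn2real S + 1)"
    by (simp add: ennreal_plus less_top)
  show ?thesis
  proof (rule that)
    show "0 < enn2real S + 1"
      by (simp add: add_nonneg_pos)
    fix f assume f: "f \<in> tree_space T r p" "f \<noteq> (\<lambda>v. 0)"
    have quot: "tree_norm T r q (A f) / tree_norm T r p f \<le> S"
      unfolding S_def using f by (intro SUP_upper) auto
    have "tree_norm T r p f < \<infinity>"
      using f by (simp add: tree_space_def)
    \<comment> \<open>In \<open>ennreal\<close>, dividing a nonzero value by 0 gives the top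
      element, which would contradict \<open>S < \<infinity>\<close>.\<close>
    moreover have "tree_norm T r q (A f) = 0" if "tree_norm T r p f = 0"
      using quot fin that by (auto simp: ennreal_divide_zero top_unique split: if_splits)
    ultimately have "tree_norm T r q (A f) =
        tree_norm T r q (A f) / tree_norm T r p f * tree_norm T r p f"
      by (cases "tree_norm T r p f = 0")
        (auto simp: ennreal_divide_times ennreal_mult_divide_eq ennreal_times_divide)
    also have "\<dots> \<le> ennreal (enn2real S + 1) * tree_norm T r p f"
      using quot S by (intro mult_right_mono) auto
    finally show "tree_norm T r q (A f) \<le> ennreal (enn2real S + 1) * tree_norm T r p f" .
  qed
qed

lemma level_mean_le_tree_norm: "ennreal (level_mean T r p n f) \<le> tree_norm T r p f"
  unfolding tree_norm_def by (rule SUP_upper) simp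

lemma cmod_le_level_mean_infinity:
  assumes "finite (tree_sphere T r n)" "v \<in> tree_sphere T r n"
  shows "cmod (f v) \<le> level_mean T r \<infinity> n f"
  using assms by (simp add: level_mean_def)

text \<open>An average of p-th powers is at least \<open>a powr p\<close> when each of them is, and
  taking p-th roots is monotone.\<close>

lemma level_mean_ge:
  assumes "finite (tree_sphere T r n)" "tree_sphere T r n \<noteq> {}" "0 < p" "0 \<le> a"
    and "\<And>v. v \<in> tree_sphere T r n \<Longrightarrow> a \<le> cmod (f v)"
  shows "a \<le> level_mean T r (ereal p) n f"
proof -
  define c where "c = real (card (tree_sphere T r n))"
  have "0 < c"
    using assms by (simp add: c_def card_gt_0_iff)
  have "c * a powr p \<le> (\<Sum>v\<in>tree_sphere T r n. cmod (f v) powr p)"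
    unfolding c_def using assms by (intro sum_bounded_below powr_mono2) auto
  with \<open>0 < c\<close> have "a powr p \<le> 1 / c * (\<Sum>v\<in>tree_sphere T r n. cmod (f v) powr p)"
    by (simp add: field_simps)
  then have "(a powr p) powr (1 / p) \<le> level_mean T r (ereal p) n f"
    using assms by (simp add: level_mean_def c_def powr_mono2)
  with assms show ?thesis
    by (simp add: powr_powr)
qed

text \<open>Only the level \<open>n\<close> of \<open>v\<close> contributes: the sum there is 1, so
  the mean is the p-th root of \<open>1 / c\<close>, with \<open>c\<close> the size of the sphere.
  Spheres of different levels are disjoint, so every other mean is 0.\<close>

lemma tree_norm_indicator_vertex_le:
  assumes "finite (tree_sphere T r n)" "v \<in> tree_sphere T r n" "0 < p"
  shows "tree_norm T r (ereal p) (indicator {v})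
    \<le> ennreal (real (card (tree_sphere T r n)) powr (- 1 / p))"
  unfolding tree_norm_def
proof (rule SUP_least, rule ennreal_leI)
  fix m
  have pow: "cmod (indicator {v} w) powr p = indicator {v} w" for w
    by (simp add: indicator_def)
  have "level_mean T r (ereal p) m (indicator {v}) =
      (1 / real (card (tree_sphere T r m)) *
        (\<Sum>w\<in>tree_sphere T r m. indicator {v} w)) powr (1 / p)"
    by (simp add: level_mean_def pow)
  also have "\<dots> \<le> real (card (tree_sphere T r n)) powr (- 1 / p)"
  proof (cases "m = n")
    case True
    have "(\<Sum>w\<in>tree_sphere T r n. indicator {v} w :: real) = 1"
      using assms by (simp add: indicator_def sum.delta)
    then show ?thesis
      using True by (simp add: powr_divide powr_minus_divide)
  next
    case False
    then have "v \<notin> tree_sphere T r m"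
      using assms by (auto simp: tree_sphere_def)
    then have "(\<Sum>w\<in>tree_sphere T r m. indicator {v} w :: real) = 0"
      by (intro sum.neutral) (auto simp: indicator_def)
    then show ?thesis
      by simp
  qed
  finally show "level_mean T r (ereal p) m (indicator {v})
    \<le> real (card (tree_sphere T r n)) powr (- 1 / p)" .
qed

text \<open>
  The term \<open>Max {}\<close> is the unspecified value of \<open>level_mean\<close> on an empty sphere; since it does not
  depend on the level, allowing for it here makes it unnecessary to show that no sphere is empty.
\<close>

lemma tree_norm_infinity_indicator_le:
  assumes "\<And>n. finite (tree_sphere T r n)"
  shows "tree_norm T r \<infinity> (indicator S) \<le> ennreal (max 1 (Max {}))"
  unfolding tree_norm_def
proof (rule SUP_least, rule ennreal_leI)
  fix m
  show "level_mean T r \<infinity> m (indicator S) \<le> max 1 (Max {})"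
  proof (cases "tree_sphere T r m = {}")
    case False
    then have "level_mean T r \<infinity> m (indicator S) \<le> 1"
      using assms by (simp add: level_mean_def indicator_def)
    then show ?thesis by simp
  qed (simp add: level_mean_def)
qed

theorem corollary11:
  fixes T :: "'v pair_pre_digraph" and r :: 'v and p :: real
  assumes "rooted_tree T r"
    and "infinite (pverts T)"
    and "\<And>n. finite (tree_sphere T r n)"
    and "0 < p"
    and "\<not> bdd_above (range (\<lambda>n. card (tree_sphere T r n)))"
  shows "\<not> (\<exists>\<psi> :: 'v \<Rightarrow> complex. invertible_operator T r (ereal p) \<infinity> (mult_operator \<psi>))"
proof
  assume "\<exists>\<psi> :: 'v \<Rightarrow> complex. invertible_operator T r (ereal p) \<infinity> (mult_operator \<psi>)"
  then obtain \<psi> :: "'v \<Rightarrow> complex" and B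
    where M: "bounded_operator T r (ereal p) \<infinity> (mult_operator \<psi>)"
      and B: "bounded_operator T r \<infinity> (ereal p) B"
      and right_inverse: "\<And>g. g \<in> tree_space T r \<infinity> \<Longrightarrow> mult_operator \<psi> (B g) = g"
    unfolding invertible_operator_def by blast
  obtain C where "0 < C" and C: "\<And>f. f \<in> tree_space T r (ereal p) \<Longrightarrow> f \<noteq> (\<lambda>v. 0) \<Longrightarrow>
      tree_norm T r \<infinity> (mult_operator \<psi> f) \<le> ennreal C * tree_norm T r (ereal p) f"
    using bounded_operator_norm_le[OF M] by blast
  obtain D where "0 < D" and D: "\<And>g. g \<in> tree_space T r \<infinity> \<Longrightarrow> g \<noteq> (\<lambda>v. 0) \<Longrightarrow>
      tree_norm T r (ereal p) (B g) \<le> ennreal D * tree_norm T r \<infinity> g"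
    using bounded_operator_norm_le[OF B] by blast
  \<comment> \<open>A bound for the supremum norm of the indicator of any sphere, chosen before
    \<open>n\<close> is fixed so that the final estimate is uniform in the level.\<close>
  define K :: real where "K = max 1 (Max {})"
  have "0 < K"
    by (simp add: K_def)
  have bound: "real (card (tree_sphere T r n)) \<le> (C * (D * K)) powr p" for n
  proof (cases "tree_sphere T r n = {}")
    case False
    define c where "c = real (card (tree_sphere T r n))"
    have "0 < c"
      using False assms(3) by (simp add: c_def card_gt_0_iff)
    have \<psi>_le: "cmod (\<psi> v) \<le> C * c powr (- 1 / p)" if v: "v \<in> tree_sphere T r n" for v
    proof -
      have le: "tree_norm T r (ereal p) (indicator {v}) \<le> ennreal (c powr (- 1 / p))"
        unfolding c_def using assms v by (intro tree_norm_indicator_vertex_le)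
      then have "tree_norm T r (ereal p) (indicator {v}) < \<infinity>"
        using le_less_trans ennreal_less_top by fastforce
      \<comment> \<open>Besides finite norm, membership requires vanishing outside
        \<open>pverts T\<close>, which holds as spheres consist of vertices.\<close>
      with v have mem: "indicator {v} \<in> tree_space T r (ereal p)"
        by (auto simp: tree_space_def tree_sphere_def indicator_def)
      have nz: "indicator {v} \<noteq> (\<lambda>w. 0 :: complex)"
        by (metis indicator_simps(1) singletonI zero_neq_one)
      have "cmod (mult_operator \<psi> (indicator {v}) v)
          \<le> level_mean T r \<infinity> n (mult_operator \<psi> (indicator {v}))"
        by (rule cmod_le_level_mean_infinity[OF assms(3) v])
      then have "ennreal (cmod (\<psi> v)) \<le> ennreal (level_mean T r \<infinity> n (mult_operator \<psi> (indicator {v})))"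
        by (intro ennreal_leI) (simp add: mult_operator_def)
      also have "\<dots> \<le> tree_norm T r \<infinity> (mult_operator \<psi> (indicator {v}))"
        by (rule level_mean_le_tree_norm)
      also have "\<dots> \<le> ennreal C * tree_norm T r (ereal p) (indicator {v})"
        by (rule C[OF mem nz])
      also have "\<dots> \<le> ennreal C * ennreal (c powr (- 1 / p))"
        by (rule mult_left_mono[OF le]) simp
      also have "\<dots> = ennreal (C * c powr (- 1 / p))"
        using \<open>0 < C\<close> by (simp add: ennreal_mult)
      finally show ?thesis
        using \<open>0 < C\<close> by simp
    qed
    define g :: "'v \<Rightarrow> complex" where "g = indicator (tree_sphere T r n)"
    have g_le: "tree_norm T r \<infinity> g \<le> ennreal K"
      unfolding g_def K_def by (rule tree_norm_infinity_indicator_le[OF assms(3)])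
    then have "tree_norm T r \<infinity> g < \<infinity>"
      using le_less_trans ennreal_less_top by fastforce
    then have mem: "g \<in> tree_space T r \<infinity>"
      by (auto simp: tree_space_def g_def tree_sphere_def indicator_def)
    have nz: "g \<noteq> (\<lambda>w. 0)"
      using False unfolding g_def by (metis ex_in_conv indicator_simps(1) zero_neq_one)
    have inv_le: "c powr (1 / p) / C \<le> cmod (B g v)" if v: "v \<in> tree_sphere T r n" for v
    proof -
      \<comment> \<open>The right inverse identity, read at \<open>v\<close>, determines
        \<open>B g v\<close> on the sphere without knowing the form of \<open>B\<close>; in
        particular \<psi> has no zero there.\<close>
      have "\<psi> v * B g v = 1"
        using fun_cong[OF right_inverse[OF mem], of v] v by (simp add: mult_operator_def g_def)
      then have "1 = cmod (\<psi> v) * cmod (B g v)"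
        by (metis norm_mult norm_one)
      also have "\<dots> \<le> C * c powr (- 1 / p) * cmod (B g v)"
        by (rule mult_right_mono[OF \<psi>_le[OF v]]) simp
      finally show ?thesis
        using \<open>0 < C\<close> \<open>0 < c\<close> by (simp add: powr_minus field_simps)
    qed
    \<comment> \<open>The norm of \<open>B g\<close> is bounded from below by its mean on level
      \<open>n\<close> alone, where every modulus is large.\<close>
    have "ennreal (c powr (1 / p) / C) \<le> ennreal (level_mean T r (ereal p) n (B g))"
      using False assms \<open>0 < C\<close> inv_le by (intro ennreal_leI level_mean_ge) auto
    also have "\<dots> \<le> tree_norm T r (ereal p) (B g)"
      by (rule level_mean_le_tree_norm)
    also have "\<dots> \<le> ennreal D * tree_norm T r \<infinity> g"
      by (rule D[OF mem nz])
    also have "\<dots> \<le> ennreal D * ennreal K"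
      by (rule mult_left_mono[OF g_le]) simp
    also have "\<dots> = ennreal (D * K)"
      using \<open>0 < D\<close> \<open>0 < K\<close> by (simp add: ennreal_mult)
    finally have "c powr (1 / p) / C \<le> D * K"
      using \<open>0 < D\<close> \<open>0 < K\<close> by simp
    then have "c powr (1 / p) \<le> C * (D * K)"
      using \<open>0 < C\<close> by (simp add: field_simps)
    \<comment> \<open>Raising to the power \<open>p\<close> isolates \<open>c\<close>; the right
      side does not depend on \<open>n\<close>.\<close>
    then have "(c powr (1 / p)) powr p \<le> (C * (D * K)) powr p"
      using \<open>0 < p\<close> by (intro powr_mono2) auto
    then show ?thesis
      using \<open>0 < p\<close> \<open>0 < c\<close> by (simp add: powr_powr c_def)
  qed simp
  have "bdd_above (range (\<lambda>n. card (tree_sphere T r n)))"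
  proof (rule bdd_aboveI2)
    \<comment> \<open>Cardinalities are natural numbers, so the real bound may be rounded
      down.\<close>
    show "card (tree_sphere T r n) \<le> nat \<lfloor>(C * (D * K)) powr p\<rfloor>" for n
      using bound[of n] by (rule le_nat_floor)
  qed
  with assms(5) show False by contradiction
qed

end
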